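(* Let $\gamma\in\mathbb{R}$ and $\alpha\in\mathbb{R}\setminus(\mathfrak{L}\cup\mathbb{Q})$. Then, under the assumption that the Duffin–Schaeffer Conjecture is true, $$\liminf_{n\to\infty}\,n(\log n)^2\,\|n\alpha-\gamma\|\,\|n\beta\|=0\qquad\text{for almost all }\beta\in\mathbb{R}.$$
   Context: $\|x\|$ denotes the distance from $x\in\mathbb{R}$ to the nearest integer. "Almost all" is with respect to Lebesgue measure. $\mathfrak{L}$ denotes the set of Liouville numbers, i.e. of $\alpha\in\mathbb{R}\setminus\mathbb{Q}$ such that $\liminf_{n\to\infty}n^w\|n\alpha\|=0$ for all $w>0$. The Duffin–Schaeffer Conjecture is the following statement: for every function $\Psi:\mathbb{N}\to(0,+\infty)$ such that $\sum_{n=1}^\infty\frac{\varphi(n)}{n}\Psi(n)=\infty$ (where $\varphi$ is the Euler phi function), for almost all $x\in\mathbb{R}$ the inequality $|nx-r|<\Psi(n)$ holds for infinitely many coprime pairs $(n,r)\in\mathbb{N}\times\mathbb{Z}$. *)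

theory Defs
  imports "HOL-Analysis.Analysis" "HOL-Number_Theory.Totient"
begin

definition dist_int :: "real \<Rightarrow> real" where
  "dist_int x = infdist x \<int>"

text \<open>Lower limits are taken in the extended reals, since \<^const>\<open>Liminf\<close> need not be
  meaningful for unbounded real sequences.\<close>

definition Liouville_numbers :: "real set" where
  "Liouville_numbers =
     {\<alpha>. \<alpha> \<notin> \<rat> \<and>
          (\<forall>w::real. w > 0 \<longrightarrow>
             liminf (\<lambda>n. ereal (real n powr w * dist_int (real n * \<alpha>))) = 0)}"

text \<open>The positive integers are encoded as \<open>n \<ge> 1\<close>: nothing is assumed about \<open>\<Psi> 0\<close>.\<close>

definition Duffin_Schaeffer_conjecture :: bool where
  "Duffin_Schaeffer_conjecture \<longleftrightarrow>
     (\<forall>\<Psi> :: nat \<Rightarrow> real.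
        (\<forall>n\<ge>1. \<Psi> n > 0) \<longrightarrow>
        filterlim (\<lambda>N. \<Sum>n=1..N. real (totient n) / real n * \<Psi> n) at_top sequentially \<longrightarrow>
        (AE x in lebesgue.
           infinite {(n :: nat, r :: int). n \<ge> 1 \<and> coprime (int n) r \<and>
                       \<bar>real n * x - real_of_int r\<bar> < \<Psi> n}))"

end

theory Submission
  imports Defs "HOL-Analysis.Kronecker_Approximation_Theorem"
begin

text \<open>
Write \<open>\<parallel>x\<parallel>\<close> for the distance to the nearest integer.  For fixed \<open>\<epsilon> > 0\<close> the Duffin-Schaeffer
conjecture is used with \<open>\<Psi>(n) = \<epsilon> / (n (log n)\<^sup>2 \<parallel>n \<alpha> - \<gamma>\<parallel>)\<close>.  For almost all \<open>\<beta>\<close> it makes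
\<open>n (log n)\<^sup>2 \<parallel>n \<alpha> - \<gamma>\<parallel> \<parallel>n \<beta>\<parallel> \<le> \<epsilon>\<close> hold for infinitely many \<open>n\<close>; letting \<open>\<epsilon>\<close> run through \<open>1 / (k + 1)\<close>
gives the theorem (\<open>liminf_le_of_approximations\<close>).  What has to be shown is that
\<open>\<Sum> \<phi>(n) / n * \<Psi>(n)\<close> diverges (\<open>critical_series_diverges\<close>).

It suffices that on dyadic blocks \<open>N \<le> n < 2 N\<close>, with \<open>N\<close> running through the powers of a fixed power
of \<open>2\<close>, the sum of \<open>\<phi>(n) / (n \<parallel>n \<alpha> - \<gamma>\<parallel>)\<close> is at least a constant times \<open>N log N\<close>: the \<open>j\<close>-th block
then contributes at least a constant times \<open>1 / j\<close> to the series.  Decomposing \<open>1 / \<parallel>n \<alpha> - \<gamma>\<parallel>\<close> over the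
scales \<open>\<delta> = 2 ^ (-i)\<close>, this follows once the sum of \<open>\<phi>(n) / n\<close> over the Bohr set
\<open>{N \<le> n < 2 N. \<parallel>n \<alpha> - \<gamma>\<parallel> \<le> \<delta>}\<close> is shown to be at least a constant times \<open>N \<delta>\<close> for all \<open>\<delta>\<close> from
a small negative power of \<open>N\<close> up to \<open>1\<close> (\<open>sum_totient_ratio_Bohr_ge\<close>), since the number of scales is
of order \<open>log N\<close>.

The Diophantine hypothesis enters through rational approximations.  If \<open>\<alpha>\<close> is irrational and not a
Liouville number, then for some \<open>W\<close> and \<open>c > 0\<close> all \<open>\<parallel>n \<alpha>\<parallel>\<close> are at least \<open>c / n ^ W\<close>.  Hence, with \<open>M\<close>
large and \<open>N = M ^ (2 W + 2)\<close>, every \<open>d \<alpha>\<close> with \<open>1 \<le> d \<le> M\<close> has an approximation \<open>p / q\<close> from Dirichlet's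
theorem whose denominator lies between \<open>M\<close> and \<open>N / M\<close> (\<open>approximation_denominator_between\<close>).
In any \<open>q\<close> consecutive multiples of \<open>d \<alpha>\<close> the residues modulo \<open>q\<close> are each approached once, so intervals
of length well above \<open>1 / q\<close> receive the expected number of points up to constants.  With \<open>d = 1\<close> this
shows that the Bohr set has at least a constant times \<open>N \<delta>\<close> elements; for larger \<open>d\<close> it shows that
\<open>O(N \<delta> / d)\<close> of them are divisible by \<open>d\<close>.  Consequently \<open>\<sigma>(n) / n\<close>, the sum of the
reciprocals of the divisors, has bounded mean on the Bohr set, and because
\<open>\<phi>(n) / n\<close> is at least half the reciprocal of \<open>\<sigma>(n) / n\<close> (\<open>totient_ratio_ge\<close>), convexity bounds the mean of
\<open>\<phi>(n) / n\<close> from below.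
\<close>

section \<open>Distance to the nearest integer\<close>

lemma dist_int_nonneg: "dist_int x \<ge> 0"
  by (simp add: dist_int_def infdist_nonneg)

lemma dist_int_le: "dist_int x \<le> \<bar>x - of_int r\<bar>"
  unfolding dist_int_def dist_real_def[symmetric] by (rule infdist_le) simp

lemma dist_int_attained:
  obtains r :: int where "dist_int x = \<bar>x - of_int r\<bar>"
proof -
  have "(\<int> :: real set) \<noteq> {}"
    using Ints_0 by blast
  then obtain z where "z \<in> (\<int> :: real set)" "infdist x \<int> = dist x z"
    using infdist_attains_inf[OF closed_Ints] by metis
  then show thesis
    using that by (auto simp: dist_int_def dist_real_def elim!: Ints_cases)
qed

lemma dist_int_perturb: "dist_int x \<le> dist_int y + \<bar>x - y\<bar>"
  unfolding dist_int_def dist_real_def[symmetric] by (rule infdist_triangle)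

lemma dist_int_le_add_int: "dist_int x \<le> dist_int (x + of_int k)"
proof -
  obtain r where "dist_int (x + of_int k) = \<bar>x + of_int k - of_int r\<bar>"
    using dist_int_attained by blast
  then show ?thesis
    using dist_int_le[of x "r - k"] by (simp add: algebra_simps)
qed

lemma dist_int_add_int: "dist_int (x + of_int k) = dist_int x"
  using dist_int_le_add_int[of x k] dist_int_le_add_int[of "x + of_int k" "-k"] by simp

lemma dist_int_ge_min:
  assumes "0 \<le> x" "x \<le> 1"
  shows "dist_int x \<ge> min x (1 - x)"
proof -
  obtain r :: int where r: "dist_int x = \<bar>x - of_int r\<bar>"
    using dist_int_attained by blast
  have "r \<le> 0 \<or> 1 \<le> r" by linarith
  then have "real_of_int r \<le> 0 \<or> 1 \<le> real_of_int r" by simp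
  then show ?thesis using r assms by auto
qed

lemma dist_int_eq_0_iff: "dist_int x = 0 \<longleftrightarrow> x \<in> \<int>"
proof
  assume "dist_int x = 0"
  then show "x \<in> \<int>"
    using dist_int_attained[of x] by (metis Ints_of_int abs_eq_0 eq_iff_diff_eq_0)
next
  assume "x \<in> \<int>"
  then show "dist_int x = 0"
    by (metis Ints_cases abs_zero cancel_comm_monoid_add_class.diff_cancel dist_int_le dist_int_nonneg order_antisym)
qed

section \<open>Multiples of a number close to a fraction\<close>

text \<open>Inside \<open>q\<close> consecutive multiples the accumulated error of \<open>\<theta> \<approx> p / q\<close> is at most \<open>1 / q\<close>,
  so the multiples sit, up to \<open>2 / q\<close>, on the points \<open>t / q\<close>, each residue \<open>t\<close> being hit exactly
  once because \<open>p\<close> is invertible modulo \<open>q\<close>.\<close>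

lemma multiples_near_residues:
  fixes a \<theta> :: real and p :: int and q :: nat
  assumes "q > 0" "coprime p (int q)" "\<bar>real q * \<theta> - of_int p\<bar> \<le> 1 / real q"
  obtains t :: "nat \<Rightarrow> int" where "bij_betw t {..<q} {0..<int q}"
    and "\<And>k. k < q \<Longrightarrow> \<bar>dist_int (a + real k * \<theta>) - dist_int (of_int (t k) / real q)\<bar> \<le> 2 / real q"
proof -
  define s where "s = \<lfloor>real q * a\<rfloor>"
  define t where "t k = (s + int k * p) mod int q" for k :: nat
  have inj: "inj_on t {..<q}"
  proof (rule inj_onI)
    fix i j assume ij: "i \<in> {..<q}" "j \<in> {..<q}" "t i = t j"
    then have "int q dvd (s + int i * p) - (s + int j * p)"
      unfolding t_def by (simp add: mod_eq_dvd_iff)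
    then have "int q dvd (int i - int j) * p"
      by (simp add: algebra_simps)
    then have "int q dvd int i - int j"
      using assms(2) by (simp add: coprime_commute coprime_dvd_mult_left_iff)
    then have "int i mod int q = int j mod int q"
      by (simp add: mod_eq_dvd_iff)
    then show "i = j" using ij by simp
  qed
  have sub: "t ` {..<q} \<subseteq> {0..<int q}"
    using assms(1) by (auto simp: t_def)
  have "card (t ` {..<q}) = card {0..<int q}"
    using card_image[OF inj] by simp
  then have "t ` {..<q} = {0..<int q}"
    by (intro card_subset_eq sub) auto
  then have bij: "bij_betw t {..<q} {0..<int q}"
    using inj by (simp add: bij_betw_def)
  show thesis
  proof (rule that[OF bij])
    fix k assume k: "k < q"
    define b where "b = a + real k * \<theta>"
    define e where "e = real q * b - of_int (s + int k * p)"
    have "e = (real q * a - of_int s) + real k * (real q * \<theta> - of_int p)"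
      by (simp add: e_def b_def algebra_simps)
    moreover have "\<bar>real q * a - of_int s\<bar> \<le> 1"
      unfolding s_def by linarith
    moreover have "\<bar>real k * (real q * \<theta> - of_int p)\<bar> \<le> real q * (1 / real q)"
      unfolding abs_mult using k assms(3) by (intro mult_mono) auto
    ultimately have e: "\<bar>e\<bar> \<le> 2"
      using assms(1) by simp
    define c where "c = (s + int k * p) div int q"
    have "s + int k * p = c * int q + t k"
      by (simp add: c_def t_def)
    then have "real q * b = of_int c * real q + of_int (t k) + e"
      by (metis add.commute diff_add_cancel e_def of_int_add of_int_mult of_int_of_nat_eq)
    then have b: "b = (of_int (t k) / real q + of_int c) + e / real q"
      using assms(1) by (simp add: field_simps)
    have "\<bar>e / real q\<bar> \<le> 2 / real q"
      using e by (simp add: divide_right_mono)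
    moreover have "\<bar>dist_int b - dist_int (of_int (t k) / real q + of_int c)\<bar> \<le> \<bar>e / real q\<bar>"
      using dist_int_perturb[of b "of_int (t k) / real q + of_int c"]
        dist_int_perturb[of "of_int (t k) / real q + of_int c" b] unfolding b by simp
    ultimately show "\<bar>dist_int (a + real k * \<theta>) - dist_int (of_int (t k) / real q)\<bar> \<le> 2 / real q"
      by (simp add: dist_int_add_int b_def)
  qed
qed

text \<open>The residues \<open>0, ..., q \<delta> - 2\<close> give points \<open>t / q\<close> within \<open>\<delta> - 2 / q\<close> of \<open>0\<close>, which leaves room for the
error \<open>2 / q\<close>.  The bound \<open>\<delta> \<le> 1\<close> ensures that these are residues.\<close>

lemma block_count_lower:
  fixes a \<theta> \<delta> :: real and p :: int and q :: nat
  assumes q: "q > 0" and "coprime p (int q)" "\<bar>real q * \<theta> - of_int p\<bar> \<le> 1 / real q"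
    and \<delta>: "\<delta> \<le> 1"
  shows "real q * \<delta> - 2 \<le> real (card {k\<in>{..<q}. dist_int (a + real k * \<theta>) \<le> \<delta>})"
proof -
  obtain t where t: "bij_betw t {..<q} {0..<int q}"
    "\<And>k. k < q \<Longrightarrow> \<bar>dist_int (a + real k * \<theta>) - dist_int (of_int (t k) / real q)\<bar> \<le> 2 / real q"
    using multiples_near_residues[OF assms(1-3)] by metis
  let ?A = "{k\<in>{..<q}. dist_int (a + real k * \<theta>) \<le> \<delta>}"
  define m where "m = \<lfloor>real q * \<delta>\<rfloor> - 2"
  have m: "of_int m \<le> real q * \<delta> - 2" "real q * \<delta> - 3 \<le> of_int m"
    unfolding m_def by linarith+
  have "real q * \<delta> \<le> real q * 1"
    using \<delta> by (intro mult_left_mono) auto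
  then have mq: "m < int q" using m by linarith
  have "{0..m} \<subseteq> t ` ?A"
  proof
    fix u assume u: "u \<in> {0..m}"
    then have "u \<in> t ` {..<q}"
      using t(1) mq by (simp add: bij_betw_def)
    then obtain k where k: "k < q" "t k = u" by auto
    have "dist_int (of_int u / real q) \<le> of_int u / real q"
      using dist_int_le[of "of_int u / real q" 0] u by simp
    also have "\<dots> \<le> (real q * \<delta> - 2) / real q"
      using u m by (intro divide_right_mono) auto
    also have "\<dots> = \<delta> - 2 / real q"
      using q by (simp add: field_simps)
    finally have "dist_int (a + real k * \<theta>) \<le> \<delta>"
 using t(2)[OF k(1), unfolded k(2)] by linarith
    then show "u \<in> t ` ?A" using k by auto
  qed
  then have "card {0..m} \<le> card (t ` ?A)" by (intro card_mono) auto
  also have "\<dots> \<le> card ?A" by (rule card_image_le) auto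
  finally have "nat (m + 1) \<le> card ?A" by simp
  then show ?thesis using m by linarith
qed

text \<open>A multiple within \<open>\<delta>\<close> of an integer comes from a residue within \<open>q \<delta> + 2\<close> of \<open>0\<close> or of \<open>q\<close>, and there
are at most \<open>q \<delta> + 3\<close> residues of either kind.\<close>

lemma block_count_upper:
  fixes a \<theta> \<delta> :: real and p :: int and q :: nat
  assumes q: "q > 0" and "coprime p (int q)" "\<bar>real q * \<theta> - of_int p\<bar> \<le> 1 / real q"
    and \<delta>: "\<delta> \<ge> 0"
  shows "real (card {k\<in>{..<q}. dist_int (a + real k * \<theta>) \<le> \<delta>}) \<le> 2 * real q * \<delta> + 6"
proof -
  obtain t where t: "bij_betw t {..<q} {0..<int q}"
    "\<And>k. k < q \<Longrightarrow> \<bar>dist_int (a + real k * \<theta>) - dist_int (of_int (t k) / real q)\<bar> \<le> 2 / real q"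
    using multiples_near_residues[OF assms(1-3)] by metis
  let ?A = "{k\<in>{..<q}. dist_int (a + real k * \<theta>) \<le> \<delta>}"
  define m where "m = \<lfloor>real q * \<delta>\<rfloor> + 2"
  have m: "of_int m \<le> real q * \<delta> + 2" "m \<ge> 0"
    using \<delta> by (simp_all add: m_def)
  have "t ` ?A \<subseteq> {0..m} \<union> {int q - m..int q}"
  proof
    fix u assume "u \<in> t ` ?A"
    then obtain k where k: "k < q" "t k = u" "dist_int (a + real k * \<theta>) \<le> \<delta>" by auto
    have u: "0 \<le> u" "u < int q"
      using t(1) k by (auto simp: bij_betw_def)
    have "min (of_int u / real q) (1 - of_int u / real q) \<le> dist_int (of_int u / real q)"
      using u by (intro dist_int_ge_min) (auto simp: divide_simps)
    also have "\<dots> \<le> \<delta> + 2 / real q"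
      using t(2)[OF k(1), unfolded k(2)] k(3) by linarith
    finally have "of_int u / real q \<le> \<delta> + 2 / real q \<or> 1 - of_int u / real q \<le> \<delta> + 2 / real q"
      by linarith
    moreover have "1 - of_int u / real q = (real q - of_int u) / real q"
      "\<delta> + 2 / real q = (real q * \<delta> + 2) / real q"
      using q by (simp_all add: field_simps)
    ultimately have "of_int u \<le> real q * \<delta> + 2 \<or> real q - of_int u \<le> real q * \<delta> + 2"
      using q by (simp add: divide_le_cancel)
    then have "u \<le> m \<or> int q - u \<le> m"
      unfolding m_def by linarith
    then show "u \<in> {0..m} \<union> {int q - m..int q}" using u by auto
  qed
  then have "card (t ` ?A) \<le> card ({0..m} \<union> {int q - m..int q})"
    by (intro card_mono) auto
  also have "\<dots> \<le> card {0..m} + card {int q - m..int q}"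
    by (rule card_Un_le)
  also have "\<dots> = 2 * nat (m + 1)" by simp
  finally have "card (t ` ?A) \<le> 2 * nat (m + 1)" .
  moreover have "inj_on t ?A"
    using t(1) by (auto simp: bij_betw_def intro: inj_on_subset)
  ultimately have "card ?A \<le> 2 * nat (m + 1)"
    by (simp add: card_image)
  then show ?thesis using m by linarith
qed

lemma card_interval_blocks:
  fixes P :: "nat \<Rightarrow> bool"
  shows "card {n\<in>{A..<A + b * q}. P n} = (\<Sum>i<b. card {k\<in>{..<q}. P (A + i * q + k)})"
proof (induction b)
  case (Suc b)
  have "{n\<in>{A..<A + Suc b * q}. P n} =
      {n\<in>{A..<A + b * q}. P n} \<union> (\<lambda>k. A + b * q + k) ` {k\<in>{..<q}. P (A + b * q + k)}" (is "?L = ?U \<union> ?V")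
  proof (intro equalityI subsetI)
    fix n assume n: "n \<in> ?L"
    show "n \<in> ?U \<union> ?V"
    proof (cases "n < A + b * q")
      case False
      then have "n = A + b * q + (n - (A + b * q))" "n - (A + b * q) < q" using n by auto
      then show ?thesis using n by (metis (mono_tags, lifting) UnI2 image_eqI lessThan_iff mem_Collect_eq)
    qed (use n in auto)
  qed auto
  moreover have "card (?U \<union> ?V) = card ?U + card ?V"
    by (intro card_Un_disjoint) auto
  moreover have "card ?V = card {k\<in>{..<q}. P (A + b * q + k)}"
    by (intro card_image) (auto intro: inj_onI)
  ultimately show ?case using Suc.IH by simp
qed simp

lemma interval_count_lower:
  fixes \<gamma> \<theta> \<delta> :: real and p :: int and q :: nat
  assumes "q > 0" "coprime p (int q)" "\<bar>real q * \<theta> - of_int p\<bar> \<le> 1 / real q" "\<delta> \<le> 1"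
    and "b * q \<le> L"
  shows "real b * (real q * \<delta> - 2) \<le> real (card {n\<in>{A..<A + L}. dist_int (real n * \<theta> - \<gamma>) \<le> \<delta>})"
proof -
  have "real b * (real q * \<delta> - 2) =
      (\<Sum>i<b. real q * \<delta> - 2)" by simp
  also have "\<dots> \<le> (\<Sum>i<b. real (card {k\<in>{..<q}. dist_int (real (A + i * q + k) * \<theta> - \<gamma>) \<le> \<delta>}))"
  proof (rule sum_mono)
    fix i
    have "real (A + i * q + k) * \<theta> - \<gamma> = (real (A + i * q) * \<theta> - \<gamma>) + real k * \<theta>" for k
      by (simp add: algebra_simps)
    then show "real q * \<delta> - 2 \<le> real (card {k\<in>{..<q}. dist_int (real (A + i * q + k) * \<theta> - \<gamma>) \<le> \<delta>})"
      using block_count_lower[OF assms(1-4), of "real (A + i * q) * \<theta> - \<gamma>"] by presburger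
  qed
  also have "\<dots> = real (card {n\<in>{A..<A + b * q}. dist_int (real n * \<theta> - \<gamma>) \<le> \<delta>})"
    by (subst card_interval_blocks) simp
  also have "\<dots> \<le> real (card {n\<in>{A..<A + L}. dist_int (real n * \<theta> - \<gamma>) \<le> \<delta>})"
    using assms(5) by (intro of_nat_mono card_mono) auto
  finally show ?thesis .
qed

lemma interval_count_upper:
  fixes \<gamma> \<theta> \<delta> :: real and p :: int and q :: nat
  assumes "q > 0" "coprime p (int q)" "\<bar>real q * \<theta> - of_int p\<bar> \<le> 1 / real q" "\<delta> \<ge> 0"
    and "L \<le> b * q"
  shows "real (card {n\<in>{A..<A + L}. dist_int (real n * \<theta> - \<gamma>) \<le> \<delta>}) \<le> real b * (2 * real q * \<delta> + 6)"
proof -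
  have "real (card {n\<in>{A..<A + L}. dist_int (real n * \<theta> - \<gamma>) \<le> \<delta>})
      \<le> real (card {n\<in>{A..<A + b * q}. dist_int (real n * \<theta> - \<gamma>) \<le> \<delta>})"
    using assms(5) by (intro of_nat_mono card_mono) auto
  also have "\<dots> = (\<Sum>i<b. real (card {k\<in>{..<q}. dist_int (real (A + i * q + k) * \<theta> - \<gamma>) \<le> \<delta>}))"
    by (subst card_interval_blocks) simp
  also have "\<dots> \<le> (\<Sum>i<b. 2 * real q * \<delta> + 6)"
  proof (rule sum_mono)
    fix i
    have "real (A + i * q + k) * \<theta> - \<gamma> = (real (A + i * q) * \<theta> - \<gamma>) + real k * \<theta>" for k
      by (simp add: algebra_simps)
    then show "real (card {k\<in>{..<q}. dist_int (real (A + i * q + k) * \<theta> - \<gamma>) \<le> \<delta>}) \<le> 2 * real q * \<delta> + 6"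
      using block_count_upper[OF assms(1-4), of "real (A + i * q) * \<theta> - \<gamma>"] by presburger
  qed
  finally show ?thesis by simp
qed

section \<open>The totient and the sum of reciprocal divisors\<close>

text \<open>The function \<open>\<sigma>(n) / n\<close>.  It controls \<open>n / \<phi>(n)\<close> and, unlike \<open>\<phi>(n) / n\<close>, it is a sum over
divisors with positive weights, so upper bounds for its averages only require upper bounds for
the number of multiples of each \<open>d\<close>.\<close>

definition recip_divisor_sum :: "nat \<Rightarrow> real" where
  "recip_divisor_sum n = (\<Sum>d | d dvd n. 1 / real d)"

lemma prod_one_minus_inverse_squares: "n \<ge> 1 \<Longrightarrow> (\<Prod>k=2..n. 1 - 1 / (real k)\<^sup>2) = (real n + 1) / (2 * real n)"
proof (induction n rule: dec_induct)
  case (step n)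
  then have "(\<Prod>k=2..Suc n. 1 - 1 / (real k)\<^sup>2) = (real n + 1) / (2 * real n) * (1 - 1 / (real (Suc n))\<^sup>2)"
    by (subst prod.nat_ivl_Suc') (auto simp: mult.commute)
  also have "\<dots> = (real (Suc n) + 1) / (2 * real (Suc n))"
    using step.hyps by (simp add: divide_simps power2_eq_square) (simp add: algebra_simps)
  finally show ?case .
qed simp

text \<open>Enlarging the index set to a full interval only inserts factors below \<open>1\<close>, and there the product
telescopes.\<close>

lemma prod_one_minus_inverse_square_ge:
  assumes "finite A" "\<And>k. k \<in> A \<Longrightarrow> 2 \<le> k"
  shows "1 / 2 \<le> (\<Prod>k\<in>A. 1 - 1 / (real k)\<^sup>2)"
proof -
  obtain n where n: "n \<ge> 1" "A \<subseteq> {2..n}"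
  proof
    show "Max (insert 1 A) \<ge> 1" using assms by simp
    show "A \<subseteq> {2..Max (insert 1 A)}" using assms by auto
  qed
  have f: "0 \<le> 1 - 1 / (real k)\<^sup>2" "1 - 1 / (real k)\<^sup>2 \<le> 1" if "k \<ge> 2" for k
    using that by (auto simp: divide_simps)
  have "1 / 2 \<le> (real n + 1) / (2 * real n)"
    using n by (simp add: field_simps)
  also have "\<dots> = (\<Prod>k=2..n. 1 - 1 / (real k)\<^sup>2)"
    using prod_one_minus_inverse_squares n by simp
  also have "\<dots> = (\<Prod>k\<in>A. 1 - 1 / (real k)\<^sup>2) * (\<Prod>k\<in>{2..n} - A. 1 - 1 / (real k)\<^sup>2)"
    using prod.subset_diff[OF n(2)] by (simp add: mult.commute)
  also have "\<dots> \<le> (\<Prod>k\<in>A. 1 - 1 / (real k)\<^sup>2) * 1"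
    using f assms(2) by (intro mult_left_mono prod_le_1 prod_nonneg) (force simp del: diff_ge_0_iff_ge)+
  finally show ?thesis by simp
qed

text \<open>Expanding the product gives the sum of \<open>1 / d\<close> over the squarefree divisors \<open>d\<close> of \<open>n\<close>: by unique
factorisation distinct sets of primes have distinct products.\<close>

lemma prod_one_plus_inverse_primes_le:
  assumes "n > 0"
  shows "(\<Prod>p\<in>prime_factors n. 1 + 1 / real p) \<le> recip_divisor_sum n"
proof -
  let ?P = "prime_factors n"
  have fin: "finite ?P" by simp
  have pf: "prime_factors (\<Prod>X) = X" if "X \<subseteq> ?P" for X
  proof -
    have fX: "finite X" using that by (rule finite_subset) simp
    have X: "prime p" if "p \<in> X" for p using that \<open>X \<subseteq> ?P\<close> by auto
    have "0 \<notin> X" using X by (metis not_prime_0)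
    have "p \<in> prime_factors (\<Prod>X) \<longleftrightarrow> p \<in> X" for p
    proof
      assume p: "p \<in> prime_factors (\<Prod>X)"
      then have "prime p" "p dvd (\<Prod>x\<in>X. x)"
        by auto
      then obtain x where "x \<in> X" "p dvd x"
        using prime_dvd_prod_iff[OF fX, of p "\<lambda>x. x"] by auto
      then show "p \<in> X"
        using X \<open>prime p\<close> by (metis primes_dvd_imp_eq)
    next
      assume "p \<in> X"
      then show "p \<in> prime_factors (\<Prod>X)"
        using X \<open>0 \<notin> X\<close> fX dvd_prodI[OF fX, of p "\<lambda>x. x"] by (auto simp: in_prime_factors_iff)
    qed
    then show ?thesis by blast
  qed
  have inj: "inj_on (\<lambda>X. \<Prod>X) (Pow ?P)"
    by (rule inj_onI) (metis PowD pf)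
  have dvd: "\<Prod>X dvd n" if "X \<subseteq> ?P" for X
  proof -
    have "\<Prod>X dvd \<Prod>?P"
      using that by (intro prod_dvd_prod_subset) auto
    also have "\<Prod>?P dvd (\<Prod>p\<in>?P. p ^ multiplicity p n)"
      by (intro prod_dvd_prod) (auto simp: prime_factors_multiplicity intro!: dvd_power)
    also have "\<dots> = n"
      using assms by (simp add: prime_factorization_nat[symmetric])
    finally show ?thesis .
  qed
  have "(\<Prod>p\<in>?P. 1 + 1 / real p) = (\<Prod>p\<in>?P. 1 / real p + 1)"
    by (simp add: add.commute)
  also have "\<dots> = (\<Sum>X\<in>Pow ?P. (\<Prod>p\<in>X. 1 / real p))"
    by (subst prod_add[OF fin]) simp
  also have "\<dots> = (\<Sum>X\<in>Pow ?P. 1 / real (\<Prod>X))"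
    by (simp add: prod_dividef)
  also have "\<dots> = (\<Sum>d\<in>(\<lambda>X. \<Prod>X) ` Pow ?P. 1 / real d)"
    by (subst sum.reindex[OF inj]) simp
  also have "\<dots> \<le> recip_divisor_sum n"
    unfolding recip_divisor_sum_def using assms dvd by (intro sum_mono2) auto
  finally show ?thesis .
qed

lemma recip_divisor_sum_pos: "n > 0 \<Longrightarrow> recip_divisor_sum n > 0"
  unfolding recip_divisor_sum_def by (intro sum_pos) (auto intro: dvd_pos_nat)

text \<open>Since \<open>\<phi>(n) / n\<close> is the product of the \<open>1 - 1 / p\<close>, multiplying it by the product of the
\<open>1 + 1 / p\<close> leaves a product of factors \<open>1 - 1 / p\<^sup>2\<close>, which is at least \<open>1 / 2\<close>.\<close>

lemma totient_ratio_ge: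
  assumes "n > 0"
  shows "real (totient n) / real n \<ge> 1 / (2 * recip_divisor_sum n)"
proof -
  let ?P = "prime_factors n"
  have ge2: "2 \<le> p" if "p \<in> ?P" for p
    using that by (auto intro: prime_ge_2_nat)
  have "1 / 2 \<le> (\<Prod>p\<in>?P. 1 - 1 / (real p)\<^sup>2)"
    using ge2 by (intro prod_one_minus_inverse_square_ge) auto
  also have "\<dots> = (\<Prod>p\<in>?P. (1 - 1 / real p) * (1 + 1 / real p))"
    by (intro prod.cong refl) (simp add: algebra_simps power2_eq_square)
  also have "\<dots> = (\<Prod>p\<in>?P. 1 - 1 / real p) * (\<Prod>p\<in>?P. 1 + 1 / real p)"
    by (rule prod.distrib)
  also have "\<dots> \<le> (\<Prod>p\<in>?P. 1 - 1 / real p) * recip_divisor_sum n"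
    using ge2 by (intro mult_left_mono prod_one_plus_inverse_primes_le assms prod_nonneg)
      (fastforce simp: divide_simps)+
  also have "(\<Prod>p\<in>?P. 1 - 1 / real p) = real (totient n) / real n"
    using assms by (simp add: totient_formula2)
  finally show ?thesis
    using recip_divisor_sum_pos[OF assms] by (simp add: field_simps)
qed

section \<open>Denominators of good approximations to multiples of a non-Liouville number\<close>

text \<open>A positive lower limit gives the bound for all large \<open>n\<close>, and irrationality makes the finitely many
remaining values positive.  Rounding the exponent up to a natural number allows the later parameters
to be integer powers of each other.\<close>

lemma non_Liouville_lower_bound:
  assumes "\<alpha> \<notin> Liouville_numbers \<union> \<rat>"
  obtains W :: nat and c :: real where "c > 0"
    and "\<And>n. n \<ge> 1 \<Longrightarrow> c \<le> real n ^ W * dist_int (real n * \<alpha>)"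
proof -
  have irr: "\<alpha> \<notin> \<rat>" using assms by simp
  then obtain w :: real where w: "w > 0"
    "liminf (\<lambda>n. ereal (real n powr w * dist_int (real n * \<alpha>))) \<noteq> 0"
    using assms by (auto simp: Liouville_numbers_def)
  define W where "W = nat \<lceil>w\<rceil>"
  define f where "f n = real n ^ W * dist_int (real n * \<alpha>)" for n :: nat
  have "0 \<le> liminf (\<lambda>n. ereal (real n powr w * dist_int (real n * \<alpha>)))"
    by (intro Liminf_bounded always_eventually) (auto simp: dist_int_nonneg)
  then have "0 < liminf (\<lambda>n. ereal (real n powr w * dist_int (real n * \<alpha>)))"
    using w(2) by simp
  then obtain e where e: "0 < ereal e" "ereal e < liminf (\<lambda>n. ereal (real n powr w * dist_int (real n * \<alpha>)))"
    using ereal_dense2 by blast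
  then have "\<forall>\<^sub>F n in sequentially. e < real n powr w * dist_int (real n * \<alpha>)"
    using less_LiminfD[OF e(2)] by simp
  then obtain n0 where n0: "\<And>n. n \<ge> n0 \<Longrightarrow> e < real n powr w * dist_int (real n * \<alpha>)"
    by (auto simp: eventually_sequentially)
  have large: "e \<le> f n" if "n \<ge> n0" "n \<ge> 1" for n
  proof -
    have "real n powr w \<le> real n powr real W"
      using that w(1) by (intro powr_mono) (auto simp: W_def real_nat_ceiling_ge)
    also have "\<dots> = real n ^ W" using that by (simp add: powr_realpow)
    finally have "real n powr w * dist_int (real n * \<alpha>) \<le> f n"
      unfolding f_def by (intro mult_right_mono dist_int_nonneg)
    then show ?thesis using n0[OF that(1)] by linarith
  qed
  have pos: "f n > 0" if "n \<ge> 1" for n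
  proof -
    have "real n * \<alpha> \<notin> \<int>"
    proof
      assume "real n * \<alpha> \<in> \<int>"
      then have "real n * \<alpha> / real n \<in> \<rat>"
        using Ints_subset_Rats by (intro Rats_divide) auto
      then show False using irr that by simp
    qed
    then have "dist_int (real n * \<alpha>) > 0"
      using dist_int_nonneg dist_int_eq_0_iff by (metis less_eq_real_def)
    then show ?thesis using that by (simp add: f_def)
  qed
  define c where "c = Min (insert e (f ` {1..n0}))"
  have "c > 0"
    using e(1) pos by (simp add: c_def)
  moreover have "c \<le> f n" if "n \<ge> 1" for n
  proof (cases "n \<le> n0")
    case True
    then show ?thesis unfolding c_def using that by (intro Min_le) auto
  next
    case False
    have "c \<le> e" unfolding c_def by (intro Min_le) auto
    then show ?thesis using large[of n] that False by simp
  qed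
  ultimately show thesis using that unfolding f_def by metis
qed

text \<open>Dirichlet's theorem yields \<open>q \<le> Q = M ^ (2 * W + 1)\<close> with \<open>\<parallel>q d \<alpha>\<parallel> \<le> 1 / Q\<close>, while the
Diophantine condition forces \<open>(q d) ^ W \<ge> c * Q\<close>.  If \<open>q\<close> were below \<open>M\<close>, the left side would be at
most \<open>M ^ (2 * W)\<close>; the exponent of \<open>Q\<close> is chosen to contradict this.  The uniformity in \<open>d \<le> M\<close> lets
the multiples of \<open>d\<close> in a Bohr set be counted by the same method as the Bohr set itself.\<close>

lemma approximation_denominator_between:
  fixes \<alpha> c :: real and M W d :: nat
  assumes c: "c > 0" "\<And>n. n \<ge> 1 \<Longrightarrow> c \<le> real n ^ W * dist_int (real n * \<alpha>)"
    and M: "1 < c * real M" and d: "1 \<le> d" "d \<le> M"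
  obtains p :: int and q :: nat where "coprime p (int q)" "M \<le> q" "q \<le> M ^ (2 * W + 1)"
    "\<bar>real q * (real d * \<alpha>) - of_int p\<bar> \<le> 1 / real q"
proof -
  define Q where "Q = M ^ (2 * W + 1)"
  have "M > 0" using d by simp
  then have "Q > 0" by (simp add: Q_def)
  then obtain p k where pk: "coprime p k" "0 < k" "k \<le> int Q" "\<bar>of_int k * (real d * \<alpha>) - of_int p\<bar> < 1 / real Q"
    using Dirichlet_approx_coprime by metis
  define q where "q = nat k"
  have q: "q > 0" "k = int q" using pk by (auto simp: q_def)
  have qd: "q * d \<ge> 1" using q d by simp
  have "dist_int (real (q * d) * \<alpha>) \<le> 1 / real Q"
    using dist_int_le[of "real (q * d) * \<alpha>" p] pk(4) q by (simp add: mult.assoc)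
  then have "c \<le> real (q * d) ^ W * (1 / real Q)"
    using c(2)[OF qd] by (meson mult_left_mono order_trans zero_le_power of_nat_0_le_iff)
  then have 1: "c * real Q \<le> real (q * d) ^ W"
    using \<open>Q > 0\<close> by (simp add: field_simps)
  have "M \<le> q"
  proof (rule ccontr)
    assume "\<not> M \<le> q"
    then have "real (q * d) ^ W \<le> real (M * M) ^ W"
      using d by (intro power_mono of_nat_mono mult_mono) auto
    also have "\<dots> = real M ^ (2 * W)"
      by (simp add: power_mult power2_eq_square)
    also have "\<dots> < (c * real M) * real M ^ (2 * W)"
      using mult_strict_right_mono[OF M, of "real M ^ (2 * W)"] \<open>M > 0\<close> by simp
    also have "\<dots> = c * real Q" by (simp add: Q_def)
    finally show False using 1 by simp
  qed
  moreover have "1 / real Q \<le> 1 / real q"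
    using pk q by (intro divide_left_mono) auto
  then have "\<bar>real q * (real d * \<alpha>) - of_int p\<bar> \<le> 1 / real q"
    using pk(4) q(2) by simp
  moreover have "q \<le> M ^ (2 * W + 1)"
    using pk(3) q(2) unfolding Q_def by linarith
  ultimately show thesis
    using that pk(1) q(2) by blast
qed

section \<open>The totient on Bohr sets\<close>

lemma sum_inverse_squares_tail:
  assumes "1 \<le> M" "M \<le> n"
  shows "(\<Sum>d\<in>{M<..n}. 1 / (real d)\<^sup>2) \<le> 1 / real M - 1 / real n"
  using assms(2)
proof (induction n rule: dec_induct)
  case (step n)
  have "{M<..Suc n} = insert (Suc n) {M<..n}" using step by auto
  then have "(\<Sum>d\<in>{M<..Suc n}. 1 / (real d)\<^sup>2) = (\<Sum>d\<in>{M<..n}. 1 / (real d)\<^sup>2) + 1 / (real (Suc n))\<^sup>2"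
    by simp
  moreover have "1 / (real (Suc n))\<^sup>2 \<le> 1 / real n - 1 / real (Suc n)"
    using step assms(1) by (simp add: divide_simps power2_eq_square)
  ultimately show ?case using step by simp
qed simp

lemma sum_inverse_squares_le:
  assumes "1 \<le> M" shows "(\<Sum>d\<in>{1..M}. 1 / (real d)\<^sup>2) \<le> 2"
proof -
  have "{1..M} = insert 1 {1<..M}" using assms by auto
  then have "(\<Sum>d\<in>{1..M}. 1 / (real d)\<^sup>2) = 1 + (\<Sum>d\<in>{1<..M}. 1 / (real d)\<^sup>2)"
    by simp
  also have "\<dots> \<le> 1 + (1 / real 1 - 1 / real M)"
    using sum_inverse_squares_tail[of 1 M] assms by simp
  also have "\<dots> \<le> 2" by simp
  finally show ?thesis .
qed

definition Bohr_set :: "real \<Rightarrow> real \<Rightarrow> nat \<Rightarrow> real \<Rightarrow> nat set" where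
  "Bohr_set \<alpha> \<gamma> N \<delta> = {n\<in>{N..<2 * N}. dist_int (real n * \<alpha> - \<gamma>) \<le> \<delta>}"

lemma finite_Bohr_set [simp]: "finite (Bohr_set \<alpha> \<gamma> N \<delta>)"
  by (simp add: Bohr_set_def)

text \<open>The interval contains at least \<open>N / (2 * q)\<close> full blocks of length \<open>q\<close>.  As \<open>q \<ge> M\<close>, the hypothesis
\<open>\<delta> \<ge> 4 / M\<close> gives \<open>q * \<delta> \<ge> 4\<close>, and each block contributes at least \<open>q * \<delta> / 2\<close> points.\<close>

lemma card_Bohr_set_ge:
  fixes \<alpha> \<gamma> c \<delta> :: real and M W :: nat
  defines "N \<equiv> M ^ (2 * W + 2)"
  assumes c: "c > 0" "\<And>n. n \<ge> 1 \<Longrightarrow> c \<le> real n ^ W * dist_int (real n * \<alpha>)"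
    and M: "1 < c * real M" and \<delta>: "4 / real M \<le> \<delta>" "\<delta> \<le> 1"
  shows "real N * \<delta> / 4 \<le> real (card (Bohr_set \<alpha> \<gamma> N \<delta>))"
proof -
  have M0: "M > 0" using M c by (cases M) auto
  obtain p q where pq: "coprime p (int q)" "M \<le> q" "q \<le> M ^ (2 * W + 1)"
    "\<bar>real q * (real 1 * \<alpha>) - of_int p\<bar> \<le> 1 / real q"
    using approximation_denominator_between[OF c M, of 1] M0 by auto
  have q0: "q > 0" using pq M0 by simp
  have "M ^ (2 * W + 1) \<le> N"
    unfolding N_def using M0 by (intro power_increasing) auto
  then have "q \<le> N" using pq by simp
  define b where "b = N div q"
  have b: "b * q \<le> N" by (simp add: b_def)
  have "N < b * q + q"
    unfolding b_def using mod_less_divisor[OF q0, of N] div_mult_mod_eq[of N q] by linarith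
  moreover have "q \<le> b * q"
    using \<open>q \<le> N\<close> q0 div_greater_zero_iff[of N q] unfolding b_def by simp
  ultimately have "N \<le> 2 * (b * q)" by linarith
  then have b2: "real N \<le> 2 * (real b * real q)"
    by (metis of_nat_le_iff of_nat_mult of_nat_numeral)
  have "0 \<le> 4 / real M" by simp
  then have \<delta>0: "0 \<le> \<delta>" using \<delta>(1) by linarith
  have "4 \<le> real M * \<delta>" using \<delta> M0 by (simp add: field_simps)
  also have "\<dots> \<le> real q * \<delta>"
    using pq \<delta>0 by (intro mult_right_mono) auto
  finally have 4: "4 \<le> real q * \<delta>" .
  have "real N * \<delta> / 4 \<le> 2 * (real b * real q) * \<delta> / 4"
    using b2 \<delta>0 by (intro divide_right_mono mult_right_mono) auto
  also have "\<dots> = real b * (real q * \<delta> / 2)" by simp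
  also have "\<dots> \<le> real b * (real q * \<delta> - 2)"
    using 4 by (intro mult_left_mono) linarith+
  also have "\<dots> \<le> real (card (Bohr_set \<alpha> \<gamma> N \<delta>))"
    using interval_count_lower[OF q0 pq(1) _ \<delta>(2) b, of \<alpha> N \<gamma>] pq(4)
    by (simp add: Bohr_set_def mult_2)
  finally show ?thesis .
qed

text \<open>If \<open>n = d * m\<close> lies in \<open>[N, 2 N)\<close>, then \<open>N div d \<le> m\<close> and \<open>m < 2 N / d < 2 * (N div d + 1)\<close>; the
additional \<open>2\<close> in the length accounts for the rounding.\<close>

lemma multiples_in_Bohr_set:
  assumes "d > 0"
  shows "card {n\<in>Bohr_set \<alpha> \<gamma> N \<delta>. d dvd n}
    \<le> card {m\<in>{N div d..<N div d + (N div d + 2)}. dist_int (real m * (real d * \<alpha>) - \<gamma>) \<le> \<delta>}"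
    (is "card ?A \<le> card ?B")
proof -
  have "?A \<subseteq> (\<lambda>m. d * m) ` ?B"
  proof
    fix n assume n: "n \<in> ?A"
    then obtain m where m: "n = d * m" by auto
    have "N div d \<le> n div d" using n by (intro div_le_mono) (auto simp: Bohr_set_def)
    then have 1: "N div d \<le> m" using m assms by simp
    have "N < d * (N div d + 1)"
      unfolding add_mult_distrib2 mult_1_right
      using mod_less_divisor[OF assms, of N] mult_div_mod_eq[of d N] by linarith
    then have "d * m < d * (2 * (N div d + 1))"
      using n m by (simp add: Bohr_set_def)
    then have "m < 2 * (N div d + 1)" using mult_less_cancel1 by blast
    then show "n \<in> (\<lambda>m. d * m) ` ?B"
      using 1 n m by (auto simp: Bohr_set_def algebra_simps)
  qed
  then have "card ?A \<le> card ((\<lambda>m. d * m) ` ?B)"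
    by (intro card_mono) auto
  also have "\<dots> \<le> card ?B"
    by (intro card_image_le) auto
  finally show ?thesis .
qed

lemma card_multiples_trivial:
  assumes "1 \<le> d" "d \<le> 2 * N"
  shows "real (card {n\<in>Bohr_set \<alpha> \<gamma> N \<delta>. d dvd n}) \<le> 5 * real N / real d"
proof -
  have "card {n\<in>Bohr_set \<alpha> \<gamma> N \<delta>. d dvd n} \<le> card {N div d..<N div d + (N div d + 2)}"
    using assms by (intro order_trans[OF multiples_in_Bohr_set] card_mono) auto
  then have "real (card {n\<in>Bohr_set \<alpha> \<gamma> N \<delta>. d dvd n}) \<le> real (N div d) + 2"
    by simp
  also have "real (N div d) \<le> real N / real d" by (rule of_nat_div_le_of_nat)
  also have "2 \<le> 4 * real N / real d"
    using assms by (simp add: field_simps)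
  finally show ?thesis by (simp add: field_simps)
qed

text \<open>Writing \<open>n = d * m\<close> turns the condition on \<open>n \<alpha>\<close> into one on \<open>m (d \<alpha>)\<close>, so the block count applies to
\<open>d \<alpha>\<close>.  The denominator satisfies \<open>q \<le> M ^ (2 * W + 1) \<le> N / d\<close>, so rounding the number of blocks
up costs only a constant factor.\<close>

lemma card_multiples_Bohr:
  fixes \<alpha> \<gamma> c \<delta> :: real and M W :: nat
  defines "N \<equiv> M ^ (2 * W + 2)"
  assumes c: "c > 0" "\<And>n. n \<ge> 1 \<Longrightarrow> c \<le> real n ^ W * dist_int (real n * \<alpha>)"
    and M: "1 < c * real M" and \<delta>: "4 / real M \<le> \<delta>" and d: "1 \<le> d" "d \<le> M"
  shows "real (card {n\<in>Bohr_set \<alpha> \<gamma> N \<delta>. d dvd n}) \<le> 16 * real N * \<delta> / real d"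
proof -
  have M0: "M > 0" using d by simp
  obtain p q where pq: "coprime p (int q)" "M \<le> q" "q \<le> M ^ (2 * W + 1)"
    "\<bar>real q * (real d * \<alpha>) - of_int p\<bar> \<le> 1 / real q"
    using approximation_denominator_between[OF c M d] by metis
  have q0: "q > 0" using pq M0 by simp
  define A where "A = N div d"
  have "q * d \<le> M ^ (2 * W + 1) * M"
    using pq d by (intro mult_le_mono) auto
  also have "\<dots> = N" by (simp add: N_def)
  finally have qA: "q \<le> A"
    unfolding A_def using d by (simp add: less_eq_div_iff_mult_less_eq)
  define b where "b = (A + 2) div q + 1"
  have Ab: "A + 2 \<le> b * q"
    unfolding b_def using mod_less_divisor[OF q0, of "A + 2"] div_mult_mod_eq[of "A + 2" q] by (simp only: add_mult_distrib)
  have "real b \<le> real (A + 2) / real q + 1"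
    unfolding b_def using of_nat_div_le_of_nat[of "A + 2" q, where 'a=real] by simp
  also have "\<dots> = (real (A + 2) + real q) / real q"
    using q0 by (simp add: add_divide_distrib)
  also have "\<dots> \<le> 4 * real A / real q"
    using qA q0 by (intro divide_right_mono) auto
  also have "\<dots> \<le> 4 * (real N / real d) / real q"
    unfolding A_def using of_nat_div_le_of_nat[of N d, where 'a=real] by (intro divide_right_mono mult_left_mono) auto
  finally have b: "real b \<le> 4 * (real N / real d) / real q" .
  have "0 \<le> 4 / real M" by simp
  then have \<delta>0: "0 \<le> \<delta>" using \<delta> by linarith
  have "4 \<le> real M * \<delta>" using \<delta> M0 by (simp add: field_simps)
  also have "\<dots> \<le> real q * \<delta>"
    using pq \<delta>0 by (intro mult_right_mono) auto
  finally have 4: "4 \<le> real q * \<delta>" .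
  have "real (card {n\<in>Bohr_set \<alpha> \<gamma> N \<delta>. d dvd n})
      \<le> real (card {m\<in>{A..<A + (A + 2)}. dist_int (real m * (real d * \<alpha>) - \<gamma>) \<le> \<delta>})"
    unfolding A_def using multiples_in_Bohr_set d by (intro of_nat_mono) auto
  also have "\<dots> \<le> real b * (2 * real q * \<delta> + 6)"
    using interval_count_upper[OF q0 pq(1,4) \<delta>0 Ab] .
  also have "\<dots> \<le> real b * (4 * (real q * \<delta>))"
    using 4 by (intro mult_left_mono) linarith+
  also have "\<dots> \<le> 4 * (real N / real d) / real q * (4 * (real q * \<delta>))"
    using b \<delta>0 by (intro mult_right_mono) auto
  also have "\<dots> = 16 * real N * \<delta> / real d"
    using q0 by simp
  finally show ?thesis .
qed

text \<open>After interchanging the summations, divisors \<open>d \<le> M\<close> contribute \<open>O(N \<delta> / d\<^sup>2)\<close> each.  For larger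
divisors it is enough to count all multiples in the interval: the total \<open>O(N / M)\<close> is \<open>O(N \<delta>)\<close>.\<close>

lemma sum_recip_divisor_sum_Bohr:
  fixes \<alpha> \<gamma> c \<delta> :: real and M W :: nat
  defines "N \<equiv> M ^ (2 * W + 2)"
  assumes c: "c > 0" "\<And>n. n \<ge> 1 \<Longrightarrow> c \<le> real n ^ W * dist_int (real n * \<alpha>)"
    and M: "1 < c * real M" and \<delta>: "4 / real M \<le> \<delta>"
  shows "(\<Sum>n\<in>Bohr_set \<alpha> \<gamma> N \<delta>. recip_divisor_sum n) \<le> 40 * real N * \<delta>"
proof -
  let ?S = "Bohr_set \<alpha> \<gamma> N \<delta>"
  let ?g = "\<lambda>d. real (card {n\<in>?S. d dvd n})"
  have M0: "M > 0" using M c by (cases M) auto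
  then have N0: "N > 0" by (simp add: N_def)
  have "M ^ 1 \<le> N" unfolding N_def using M0 by (intro power_increasing) auto
  then have MN: "M \<le> 2 * N" by simp
  have "0 \<le> 4 / real M" by simp
  then have \<delta>0: "0 \<le> \<delta>" using \<delta> by linarith
  have "(\<Sum>n\<in>?S. recip_divisor_sum n) = (\<Sum>n\<in>?S. \<Sum>d | d \<in> {1..2 * N} \<and> d dvd n. 1 / real d)"
    unfolding recip_divisor_sum_def
  proof (intro sum.cong refl)
    fix n assume "n \<in> ?S"
    then have "0 < n" "n \<le> 2 * N" using N0 by (auto simp: Bohr_set_def)
    then show "{d. d dvd n} = {d. d \<in> {1..2 * N} \<and> d dvd n}"
      using dvd_pos_nat by (auto dest: dvd_imp_le simp: Suc_le_eq)
  qed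
  also have "\<dots> = (\<Sum>d\<in>{1..2 * N}. \<Sum>n | n \<in> ?S \<and> d dvd n. 1 / real d)"
    by (rule sum.swap_restrict) auto
  also have "\<dots> = (\<Sum>d\<in>{1..2 * N}. ?g d / real d)"
    by simp
  also have "{1..2 * N} = {1..M} \<union> {M<..2 * N}"
    using M0 MN by auto
  also have "(\<Sum>d\<in>{1..M} \<union> {M<..2 * N}. ?g d / real d) = (\<Sum>d\<in>{1..M}. ?g d / real d) + (\<Sum>d\<in>{M<..2 * N}. ?g d / real d)"
    by (intro sum.union_disjoint) auto
  also have "(\<Sum>d\<in>{1..M}. ?g d / real d) \<le> (\<Sum>d\<in>{1..M}. 16 * real N * \<delta> * (1 / (real d)\<^sup>2))"
  proof (rule sum_mono)
    fix d assume d: "d \<in> {1..M}"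
    then have "?g d / real d \<le> 16 * real N * \<delta> / real d / real d"
      using card_multiples_Bohr[OF c M \<delta>, of d \<gamma>] unfolding N_def by (intro divide_right_mono) auto
    then show "?g d / real d \<le> 16 * real N * \<delta> * (1 / (real d)\<^sup>2)"
      by (simp add: power2_eq_square)
  qed
  also have "(\<Sum>d\<in>{M<..2 * N}. ?g d / real d) \<le> (\<Sum>d\<in>{M<..2 * N}. 5 * real N * (1 / (real d)\<^sup>2))"
  proof (rule sum_mono)
    fix d assume d: "d \<in> {M<..2 * N}"
    then have "?g d / real d \<le> 5 * real N / real d / real d"
      by (intro divide_right_mono card_multiples_trivial) auto
    then show "?g d / real d \<le> 5 * real N * (1 / (real d)\<^sup>2)"
      by (simp add: power2_eq_square)
  qed
  also have "(\<Sum>d\<in>{1..M}. 16 * real N * \<delta> * (1 / (real d)\<^sup>2)) + (\<Sum>d\<in>{M<..2 * N}. 5 * real N * (1 / (real d)\<^sup>2))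
      = 16 * real N * \<delta> * (\<Sum>d\<in>{1..M}. 1 / (real d)\<^sup>2) + 5 * real N * (\<Sum>d\<in>{M<..2 * N}. 1 / (real d)\<^sup>2)"
    by (simp only: sum_distrib_left)
  also have "\<dots> \<le> 16 * real N * \<delta> * 2 + 5 * real N * (\<delta> / 4)"
  proof (intro add_mono mult_left_mono)
    show "(\<Sum>d\<in>{1..M}. 1 / (real d)\<^sup>2) \<le> 2"
      using sum_inverse_squares_le[of M] M0 by simp
    have "(\<Sum>d\<in>{M<..2 * N}. 1 / (real d)\<^sup>2) \<le> 1 / real M - 1 / real (2 * N)"
      using sum_inverse_squares_tail[of M "2 * N"] M0 MN by simp
    also have "\<dots> \<le> 1 / real M" by simp
    also have "\<dots> \<le> \<delta> / 4" using \<delta> by simp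
    finally show "(\<Sum>d\<in>{M<..2 * N}. 1 / (real d)\<^sup>2) \<le> \<delta> / 4" .
    show "0 \<le> 16 * real N * \<delta>"
      using \<delta>0 by simp
  qed auto
  also have "\<dots> \<le> 40 * real N * \<delta>"
  proof -
    have "0 \<le> real N * \<delta>"
      using \<delta>0 by simp
    then show ?thesis by linarith
  qed
  finally show ?thesis by simp
qed

text \<open>The reciprocal is convex, so \<open>1 / f\<close> lies above its tangent at \<open>f = 160\<close>; summing the tangent
inequality for \<open>f = \<sigma>(n) / n\<close> needs only the cardinality and the sum of \<open>f\<close> over the Bohr set.  The
point \<open>160\<close> bounds the mean of \<open>f\<close>, as \<open>f\<close> has sum at most \<open>40 N \<delta>\<close> over at least \<open>N \<delta> / 4\<close> elements.\<close>

lemma sum_totient_ratio_Bohr_ge: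
  fixes \<alpha> \<gamma> c \<delta> :: real and M W :: nat
  defines "N \<equiv> M ^ (2 * W + 2)"
  assumes c: "c > 0" "\<And>n. n \<ge> 1 \<Longrightarrow> c \<le> real n ^ W * dist_int (real n * \<alpha>)"
    and M: "1 < c * real M" and \<delta>: "4 / real M \<le> \<delta>" "\<delta> \<le> 1"
  shows "real N * \<delta> / 1280 \<le> (\<Sum>n\<in>Bohr_set \<alpha> \<gamma> N \<delta>. real (totient n) / real n)"
proof -
  let ?S = "Bohr_set \<alpha> \<gamma> N \<delta>"
  have M0: "M > 0" using M c by (cases M) auto
  then have N0: "N > 0" by (simp add: N_def)
  have "real N * \<delta> / 1280 = real N * \<delta> / 4 / 160 - 40 * real N * \<delta> / 51200"
    by simp
  also have "\<dots> \<le> real (card ?S) / 160 - (\<Sum>n\<in>?S. recip_divisor_sum n) / 51200"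
    using card_Bohr_set_ge[OF c M \<delta>, of \<gamma>] sum_recip_divisor_sum_Bohr[OF c M \<delta>(1), of \<gamma>]
    unfolding N_def by (intro diff_mono divide_right_mono) auto
  also have "\<dots> = (\<Sum>n\<in>?S. 1 / 160 - recip_divisor_sum n / 51200)"
    by (simp add: sum_subtractf sum_divide_distrib)
  also have "\<dots> \<le> (\<Sum>n\<in>?S. real (totient n) / real n)"
  proof (rule sum_mono)
    fix n assume "n \<in> ?S"
    then have n: "n > 0" using N0 by (auto simp: Bohr_set_def)
    define f where "f = recip_divisor_sum n"
    have "f > 0" using recip_divisor_sum_pos[OF n] by (simp add: f_def)
    \<comment> \<open>half of the tangent inequality \<open>1 / f \<ge> 2 / 160 - f / 160\<^sup>2\<close>\<close>
    have "1 / (2 * f) - (1 / 160 - f / 51200) = (f - 160)\<^sup>2 / (51200 * f)"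
      using \<open>f > 0\<close> by (simp add: field_simps power2_eq_square)
    also have "\<dots> \<ge> 0" using \<open>f > 0\<close> by simp
    finally show "1 / 160 - recip_divisor_sum n / 51200 \<le> real (totient n) / real n"
      using totient_ratio_ge[OF n] by (simp add: f_def)
  qed
  finally show ?thesis .
qed

section \<open>Divergence of the critical series\<close>

lemma sum_powers_below_reciprocal:
  fixes x :: real
  assumes "x > 0"
  shows "(\<Sum>i | i \<in> {..<m} \<and> x \<le> 1 / 2 ^ i. 2 ^ i) \<le> 2 / x"
proof (induction m)
  case 0
  then show ?case using assms by simp
next
  case (Suc m)
  show ?case
  proof (cases "x \<le> 1 / 2 ^ m")
    case True
    have "(\<Sum>i | i \<in> {..<Suc m} \<and> x \<le> 1 / 2 ^ i. 2 ^ i) \<le> (\<Sum>i<Suc m. (2::real) ^ i)"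
      by (intro sum_mono2) auto
    also have "\<dots> \<le> 2 * 2 ^ m"
      by (subst geometric_sum) auto
    also have "\<dots> \<le> 2 / x"
      using True assms by (simp add: field_simps)
    finally show ?thesis .
  next
    case False
    then have "{i. i \<in> {..<Suc m} \<and> x \<le> 1 / 2 ^ i} = {i. i \<in> {..<m} \<and> x \<le> 1 / 2 ^ i}"
      by (auto simp: less_Suc_eq)
    then show ?thesis using Suc.IH by simp
  qed
qed

text \<open>Up to a factor \<open>2\<close>, the quantity \<open>1 / x\<close> dominates the sum of the \<open>2 ^ i\<close> with \<open>x \<le> 2 ^ (-i)\<close>.
Each of the \<open>j - 1\<close> scales \<open>\<delta> = 2 ^ (-i) \<ge> 4 / 2 ^ j\<close> therefore contributes a constant multiple of \<open>N\<close>; this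
is the source of the extra factor \<open>log N\<close>.\<close>

lemma sum_totient_over_distance_ge:
  fixes \<alpha> \<gamma> c :: real and W j :: nat
  defines "N \<equiv> (2 ^ j) ^ (2 * W + 2)"
  assumes c: "c > 0" "\<And>n. n \<ge> 1 \<Longrightarrow> c \<le> real n ^ W * dist_int (real n * \<alpha>)"
    and j: "2 \<le> j" "1 < c * real (2 ^ j)"
    and nz: "\<And>n. n \<ge> N \<Longrightarrow> dist_int (real n * \<alpha> - \<gamma>) \<noteq> 0"
  shows "real N * real (j - 1) / 2560
    \<le> (\<Sum>n\<in>{N..<2 * N}. real (totient n) / real n / dist_int (real n * \<alpha> - \<gamma>))"
proof -
  let ?x = "\<lambda>n. dist_int (real n * \<alpha> - \<gamma>)"
  let ?w = "\<lambda>n. real (totient n) / real n"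
  have "real N * real (j - 1) / 1280 = (\<Sum>i<j - 1. real N / 1280)"
    by simp
  also have "\<dots> \<le> (\<Sum>i<j - 1. \<Sum>n | n \<in> {N..<2 * N} \<and> ?x n \<le> 1 / 2 ^ i. 2 ^ i * ?w n)"
  proof (rule sum_mono)
    fix i assume "i \<in> {..<j - 1}"
    then have "i + 2 \<le> j" by auto
    then have "(2::real) ^ (i + 2) \<le> 2 ^ j" by (intro power_increasing) auto
    then have "4 / real (2 ^ j) \<le> 1 / 2 ^ i"
      by (simp add: field_simps)
    moreover have "1 / 2 ^ i \<le> (1::real)" by simp
    ultimately have "real N * (1 / 2 ^ i) / 1280 \<le> (\<Sum>n\<in>Bohr_set \<alpha> \<gamma> N (1 / 2 ^ i). ?w n)"
      unfolding N_def by (intro sum_totient_ratio_Bohr_ge[OF c j(2)]) auto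
    then have "2 ^ i * (real N * (1 / 2 ^ i) / 1280) \<le> 2 ^ i * (\<Sum>n\<in>Bohr_set \<alpha> \<gamma> N (1 / 2 ^ i). ?w n)"
      by (intro mult_left_mono) auto
    then show "real N / 1280 \<le> (\<Sum>n | n \<in> {N..<2 * N} \<and> ?x n \<le> 1 / 2 ^ i. 2 ^ i * ?w n)"
      by (simp add: Bohr_set_def sum_distrib_left)
  qed
  also have "\<dots> = (\<Sum>n\<in>{N..<2 * N}. \<Sum>i | i \<in> {..<j - 1} \<and> ?x n \<le> 1 / 2 ^ i. 2 ^ i * ?w n)"
    by (rule sum.swap_restrict) auto
  also have "\<dots> \<le> (\<Sum>n\<in>{N..<2 * N}. 2 * (?w n / ?x n))"
  proof (rule sum_mono)
    fix n assume "n \<in> {N..<2 * N}"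
    then have "?x n > 0" using nz[of n] dist_int_nonneg[of "real n * \<alpha> - \<gamma>"] by auto
    then have "(\<Sum>i | i \<in> {..<j - 1} \<and> ?x n \<le> 1 / 2 ^ i. 2 ^ i) * ?w n \<le> 2 / ?x n * ?w n"
      by (intro mult_right_mono sum_powers_below_reciprocal) auto
    then show "(\<Sum>i | i \<in> {..<j - 1} \<and> ?x n \<le> 1 / 2 ^ i. 2 ^ i * ?w n) \<le> 2 * (?w n / ?x n)"
      unfolding sum_distrib_right by (simp only: times_divide_eq_left times_divide_eq_right mult_ac)
  qed
  finally show ?thesis
    unfolding sum_distrib_left[symmetric] by linarith
qed

text \<open>Two different integers \<open>n\<close> with \<open>n \<alpha> - \<gamma>\<close> integral would make \<open>\<alpha>\<close> rational, so at most one exists.\<close>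

lemma shifted_multiples_eventually_nonintegral:
  assumes "\<alpha> \<notin> \<rat>"
  obtains n0 :: nat where "\<And>n. n \<ge> n0 \<Longrightarrow> dist_int (real n * \<alpha> - \<gamma>) \<noteq> 0"
proof (cases "\<exists>m. dist_int (real m * \<alpha> - \<gamma>) = 0")
  case True
  then obtain m where m: "real m * \<alpha> - \<gamma> \<in> \<int>" by (auto simp: dist_int_eq_0_iff)
  have "dist_int (real n * \<alpha> - \<gamma>) \<noteq> 0" if "n \<ge> Suc m" for n
  proof
    assume "dist_int (real n * \<alpha> - \<gamma>) = 0"
    then have "(real n * \<alpha> - \<gamma>) - (real m * \<alpha> - \<gamma>) \<in> \<int>"
      using m by (simp only: dist_int_eq_0_iff Ints_diff)
    then have "(real n - real m) * \<alpha> \<in> \<rat>"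
      using Ints_subset_Rats by (auto simp: algebra_simps)
    then have "(real n - real m) * \<alpha> / (real n - real m) \<in> \<rat>"
      by (intro Rats_divide Rats_diff) auto
    then show False using assms that by simp
  qed
  then show thesis using that by blast
qed (use that in blast)

definition critical_weight :: "real \<Rightarrow> real \<Rightarrow> nat \<Rightarrow> real" where
  "critical_weight \<alpha> \<gamma> n = real n * (ln (real n))\<^sup>2 * dist_int (real n * \<alpha> - \<gamma>)"

text \<open>The value \<open>1\<close> is a placeholder which keeps the function positive at \<open>n \<le> 1\<close>, where \<open>n (log n)\<^sup>2\<close>
vanishes, and at the possible \<open>n\<close> for which \<open>n \<alpha> - \<gamma>\<close> is an integer.\<close>

definition critical_psi :: "real \<Rightarrow> real \<Rightarrow> real \<Rightarrow> nat \<Rightarrow> real" where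
  "critical_psi \<epsilon> \<alpha> \<gamma> n =
     (if critical_weight \<alpha> \<gamma> n = 0 then 1 else \<epsilon> / critical_weight \<alpha> \<gamma> n)"

lemma critical_weight_nonneg: "critical_weight \<alpha> \<gamma> n \<ge> 0"
  by (simp add: critical_weight_def dist_int_nonneg)

lemma critical_psi_pos: "\<epsilon> > 0 \<Longrightarrow> critical_psi \<epsilon> \<alpha> \<gamma> n > 0"
  using critical_weight_nonneg[of \<alpha> \<gamma> n] by (auto simp: critical_psi_def)

text \<open>On \<open>N \<le> n < 2 N\<close> the factor \<open>n (log n)\<^sup>2\<close> is at most a constant times \<open>N j\<^sup>2\<close>, because \<open>N\<close> is a
fixed power of \<open>2 ^ j\<close>.  Against the lower bound of order \<open>N j\<close> for the weighted reciprocal distances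
this leaves \<open>1 / j\<close>.\<close>

lemma critical_block_sum_ge:
  fixes \<alpha> \<gamma> c \<epsilon> :: real and W j :: nat
  defines "N \<equiv> (2 ^ j) ^ (2 * W + 2)"
  assumes c: "c > 0" "\<And>n. n \<ge> 1 \<Longrightarrow> c \<le> real n ^ W * dist_int (real n * \<alpha>)"
    and j: "2 \<le> j" "1 < c * real (2 ^ j)"
    and nz: "\<And>n. n \<ge> N \<Longrightarrow> dist_int (real n * \<alpha> - \<gamma>) \<noteq> 0"
    and \<epsilon>: "\<epsilon> > 0"
  shows "\<epsilon> / (10240 * (real (2 * W + 3))\<^sup>2) * inverse (real j)
    \<le> (\<Sum>n\<in>{N..<2 * N}. real (totient n) / real n * critical_psi \<epsilon> \<alpha> \<gamma> n)"
proof -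
  let ?x = "\<lambda>n. dist_int (real n * \<alpha> - \<gamma>)"
  let ?w = "\<lambda>n. real (totient n) / real n"
  define L where "L = real (2 * W + 3) * real j"
  have L: "L > 0" using j by (simp add: L_def)
  have N2: "2 \<le> N"
  proof -
    have "(2::nat) ^ 1 \<le> 2 ^ j"
      using j by (intro power_increasing) auto
    also have "\<dots> = (2 ^ j) ^ 1" by simp
    also have "\<dots> \<le> N"
      unfolding N_def by (intro power_increasing) auto
    finally show ?thesis by simp
  qed
  have psi: "\<epsilon> / (2 * real N * L\<^sup>2) * (?w n / ?x n) \<le> ?w n * critical_psi \<epsilon> \<alpha> \<gamma> n"
    if n: "n \<in> {N..<2 * N}" for n
  proof -
    have x: "?x n > 0" using nz[of n] n dist_int_nonneg[of "real n * \<alpha> - \<gamma>"] by auto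
    have n2: "n \<ge> 2" using n N2 by simp
    then have lnpos: "ln (real n) > 0" by simp
    have "ln (real n) \<le> ln (2 ^ (j * (2 * W + 2) + 1))"
    proof (rule ln_mono)
      have "real n \<le> real (2 * N)" using n by simp
      also have "\<dots> = 2 ^ (j * (2 * W + 2) + 1)"
        by (simp add: N_def power_mult power_add del: mult_Suc_right)
      finally show "real n \<le> 2 ^ (j * (2 * W + 2) + 1)" .
    qed (use n2 in auto)
    also have "\<dots> = real (j * (2 * W + 2) + 1) * ln 2"
      by (rule ln_realpow)
    also have "\<dots> \<le> real (j * (2 * W + 2) + 1) * 1"
      using ln_2_less_1 by (intro mult_left_mono) auto
    also have "\<dots> \<le> L"
    proof -
      have "j * (2 * W + 2) + 1 \<le> (2 * W + 3) * j"
        using j by (simp add: algebra_simps)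
      then show ?thesis unfolding L_def by (metis mult_1_right of_nat_mono of_nat_mult)
    qed
    finally have "(ln (real n))\<^sup>2 \<le> L\<^sup>2"
      using lnpos by (intro power_mono) auto
    then have "real n * (ln (real n))\<^sup>2 \<le> (2 * real N) * L\<^sup>2"
      using n by (intro mult_mono) auto
    then have D: "critical_weight \<alpha> \<gamma> n \<le> 2 * real N * L\<^sup>2 * ?x n"
      unfolding critical_weight_def using x by (intro mult_right_mono) auto
    have Dpos: "critical_weight \<alpha> \<gamma> n > 0"
      unfolding critical_weight_def using x n2 lnpos by simp
    have "\<epsilon> / (2 * real N * L\<^sup>2 * ?x n) \<le> \<epsilon> / critical_weight \<alpha> \<gamma> n"
      using D Dpos \<epsilon> by (intro frac_le) auto
    then have "?w n * (\<epsilon> / (2 * real N * L\<^sup>2 * ?x n)) \<le> ?w n * (\<epsilon> / critical_weight \<alpha> \<gamma> n)"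
      by (intro mult_left_mono) auto
    then show ?thesis using Dpos by (simp add: critical_psi_def mult_ac)
  qed
  have "\<epsilon> / (10240 * (real (2 * W + 3))\<^sup>2) * inverse (real j)
      = \<epsilon> / (2 * real N * L\<^sup>2) * (real N * (real j / 2) / 2560)"
    using N2 j by (simp add: L_def power2_eq_square divide_simps)
  also have "\<dots> \<le> \<epsilon> / (2 * real N * L\<^sup>2) * (real N * real (j - 1) / 2560)"
    using j \<epsilon> by (intro mult_left_mono divide_right_mono) (auto simp: of_nat_diff)
  also have "\<dots> \<le> \<epsilon> / (2 * real N * L\<^sup>2) * (\<Sum>n\<in>{N..<2 * N}. ?w n / ?x n)"
    using \<epsilon> sum_totient_over_distance_ge[OF c j, of \<gamma>] nz unfolding N_def
    by (intro mult_left_mono) auto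
  also have "\<dots> = (\<Sum>n\<in>{N..<2 * N}. \<epsilon> / (2 * real N * L\<^sup>2) * (?w n / ?x n))"
    by (rule sum_distrib_left)
  also have "\<dots> \<le> (\<Sum>n\<in>{N..<2 * N}. ?w n * critical_psi \<epsilon> \<alpha> \<gamma> n)"
    by (intro sum_mono psi)
  finally show ?thesis .
qed

text \<open>The blocks are disjoint, so the partial sums dominate those of a tail of the harmonic series.\<close>

lemma partial_sums_at_top_of_harmonic_blocks:
  fixes g :: "nat \<Rightarrow> real" and B :: "nat \<Rightarrow> nat"
  assumes nonneg: "\<And>n. g n \<ge> 0" and "C > 0"
    and B1: "\<And>j. 1 \<le> B j" and B2: "\<And>j. 2 * B j \<le> B (Suc j)"
    and blocks: "\<And>j. j \<ge> j0 \<Longrightarrow> C * inverse (real j) \<le> (\<Sum>n\<in>{B j..<2 * B j}. g n)"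
  shows "filterlim (\<lambda>N. \<Sum>n=1..N. g n) at_top sequentially"
proof -
  have mono: "(\<Sum>n=1..M. g n) \<le> (\<Sum>n=1..N. g n)" if "M \<le> N" for M N
    using that nonneg by (intro sum_mono2) auto
  have part: "(\<Sum>i<J. C * inverse (real (i + j0))) \<le> (\<Sum>n\<in>{1..<B (J + j0)}. g n)" for J
  proof (induction J)
    case 0
    then show ?case using nonneg by (simp add: sum_nonneg)
  next
    case (Suc J)
    have "(\<Sum>i<Suc J. C * inverse (real (i + j0)))
        \<le> (\<Sum>n\<in>{1..<B (J + j0)}. g n) + (\<Sum>n\<in>{B (J + j0)..<2 * B (J + j0)}. g n)"
      using Suc.IH blocks[of "J + j0"] by simp
    also have "\<dots> = (\<Sum>n\<in>{1..<2 * B (J + j0)}. g n)"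
      using B1[of "J + j0"] by (intro sum.atLeastLessThan_concat) auto
    also have "\<dots> \<le> (\<Sum>n\<in>{1..<B (Suc J + j0)}. g n)"
      using B2[of "J + j0"] nonneg by (intro sum_mono2) auto
    finally show ?case .
  qed
  have unbounded: "\<exists>N. Z \<le> (\<Sum>n=1..N. g n)" for Z
  proof (rule ccontr)
    assume "\<not> ?thesis"
    then have Z: "(\<Sum>n=1..N. g n) \<le> Z" for N by (meson le_cases)
    have "(\<Sum>i<J. C * inverse (real (i + j0))) \<le> Z" for J
    proof -
      have "(\<Sum>n\<in>{1..<B (J + j0)}. g n) \<le> (\<Sum>n=1..B (J + j0). g n)"
        using nonneg by (intro sum_mono2) auto
      then show ?thesis using part[of J] Z[of "B (J + j0)"] by linarith
    qed
    then have "summable (\<lambda>i. C * inverse (real (i + j0)))"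
      using \<open>C > 0\<close> by (intro summableI_nonneg_bounded) auto
    then have "summable (\<lambda>i. inverse (real (i + j0)))"
      using \<open>C > 0\<close> by (simp add: summable_cmult_iff)
    then have "summable (\<lambda>i. inverse (real i))"
      using summable_iff_shift[of "\<lambda>i. inverse (real i)" j0] by simp
    then show False using not_summable_harmonic[where 'a=real] by simp
  qed
  show ?thesis
    unfolding filterlim_at_top
  proof
    fix Z :: real
    obtain N where "Z \<le> (\<Sum>n=1..N. g n)" using unbounded by blast
    then show "\<forall>\<^sub>F M in sequentially. Z \<le> (\<Sum>n=1..M. g n)"
      unfolding eventually_sequentially using mono by (meson order_trans)
  qed
qed

lemma critical_series_diverges:
  fixes \<alpha> \<gamma> \<epsilon> :: real
  assumes \<alpha>: "\<alpha> \<notin> Liouville_numbers \<union> \<rat>" and \<epsilon>: "\<epsilon> > 0"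
  shows "filterlim (\<lambda>N. \<Sum>n=1..N. real (totient n) / real n * critical_psi \<epsilon> \<alpha> \<gamma> n) at_top sequentially"
proof -
  obtain W :: nat and c :: real where c: "c > 0"
    "\<And>n. n \<ge> 1 \<Longrightarrow> c \<le> real n ^ W * dist_int (real n * \<alpha>)"
    using non_Liouville_lower_bound[OF \<alpha>] by metis
  obtain n0 where n0: "\<And>n. n \<ge> n0 \<Longrightarrow> dist_int (real n * \<alpha> - \<gamma>) \<noteq> 0"
    using shifted_multiples_eventually_nonintegral[of \<alpha> \<gamma>] \<alpha> by auto
  obtain j1 where j1: "1 / c < 2 ^ j1"
    using real_arch_pow[of 2 "1 / c"] by auto
  define j0 where "j0 = max 2 (max j1 n0)"
  define B where "B j = ((2::nat) ^ j) ^ (2 * W + 2)" for j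
  have Bj: "2 ^ j \<le> B j" for j
    unfolding B_def using power_increasing[of 1 "2 * W + 2" "(2::nat) ^ j"] by simp
  show ?thesis
  proof (rule partial_sums_at_top_of_harmonic_blocks)
    show "0 \<le> real (totient n) / real n * critical_psi \<epsilon> \<alpha> \<gamma> n" for n
      using critical_psi_pos[OF \<epsilon>] by (simp add: less_imp_le)
    show "0 < \<epsilon> / (10240 * (real (2 * W + 3))\<^sup>2)"
      using \<epsilon> by simp
    show "1 \<le> B j" for j by (simp add: B_def)
    show "2 * B j \<le> B (Suc j)" for j
    proof -
      have "2 * B j \<le> 2 ^ (2 * W + 2) * B j"
        using power_increasing[of 1 "2 * W + 2" "2::nat"] by (intro mult_right_mono) auto
      also have "\<dots> = B (Suc j)"
        unfolding B_def power_mult_distrib[symmetric] by simp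
      finally show ?thesis .
    qed
    show "\<epsilon> / (10240 * (real (2 * W + 3))\<^sup>2) * inverse (real j)
        \<le> (\<Sum>n\<in>{B j..<2 * B j}. real (totient n) / real n * critical_psi \<epsilon> \<alpha> \<gamma> n)"
      if j: "j \<ge> j0" for j
      unfolding B_def
    proof (rule critical_block_sum_ge[OF c _ _ _ \<epsilon>])
      show "2 \<le> j" using j by (simp add: j0_def)
      have "(2::real) ^ j1 \<le> 2 ^ j" using j by (intro power_increasing) (auto simp: j0_def)
      then have "1 / c < 2 ^ j" using j1 by linarith
      then show "1 < c * real (2 ^ j)" using c(1) by (simp add: field_simps)
      fix n :: nat assume "(2 ^ j) ^ (2 * W + 2) \<le> n"
      then have "2 ^ j \<le> n" using Bj[of j] unfolding B_def by linarith
      then have "n0 \<le> n" using j less_exp[of j] unfolding j0_def by linarith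
      then show "dist_int (real n * \<alpha> - \<gamma>) \<noteq> 0" by (rule n0)
    qed
  qed
qed

section \<open>From the Duffin-Schaeffer conjecture to the lower limit\<close>

lemma finite_ints_near: "finite {r :: int. \<bar>a - real_of_int r\<bar> < b}"
proof (rule finite_subset)
  show "{r :: int. \<bar>a - real_of_int r\<bar> < b} \<subseteq> {\<lfloor>a - b\<rfloor>..\<lceil>a + b\<rceil>}"
    by (auto simp: abs_less_iff) linarith+
qed simp

text \<open>Each \<open>n\<close> admits only finitely many \<open>r\<close>, so infinitely many pairs \<open>(n, r)\<close> involve arbitrarily large
\<open>n\<close>.  For each such \<open>n\<close> the product is at most \<open>\<epsilon>\<close>: either the weight vanishes, or it
cancels against the denominator of the approximation function.\<close>

lemma liminf_le_of_approximations:
  assumes \<epsilon>: "\<epsilon> > 0"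
    and inf: "infinite {(n :: nat, r :: int). n \<ge> 1 \<and> coprime (int n) r \<and>
                \<bar>real n * \<beta> - real_of_int r\<bar> < critical_psi \<epsilon> \<alpha> \<gamma> n}"
  shows "liminf (\<lambda>n. ereal (critical_weight \<alpha> \<gamma> n * dist_int (real n * \<beta>))) \<le> ereal \<epsilon>"
proof (rule ccontr)
  assume "\<not> ?thesis"
  then have "\<forall>\<^sub>F n in sequentially. ereal \<epsilon> < ereal (critical_weight \<alpha> \<gamma> n * dist_int (real n * \<beta>))"
    by (intro less_LiminfD) (simp add: not_le)
  then obtain n0 where n0: "\<And>n. n \<ge> n0 \<Longrightarrow> \<epsilon> < critical_weight \<alpha> \<gamma> n * dist_int (real n * \<beta>)"
    by (auto simp: eventually_sequentially)
  have "{(n :: nat, r :: int). n \<ge> 1 \<and> coprime (int n) r \<and>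
        \<bar>real n * \<beta> - real_of_int r\<bar> < critical_psi \<epsilon> \<alpha> \<gamma> n}
      \<subseteq> (SIGMA n:{..<n0}. {r :: int. \<bar>real n * \<beta> - real_of_int r\<bar> < critical_psi \<epsilon> \<alpha> \<gamma> n})"
  proof safe
    fix n :: nat and r :: int
    assume r: "\<bar>real n * \<beta> - real_of_int r\<bar> < critical_psi \<epsilon> \<alpha> \<gamma> n"
    then have d: "dist_int (real n * \<beta>) < critical_psi \<epsilon> \<alpha> \<gamma> n"
      using dist_int_le[of "real n * \<beta>" r] by simp
    have "critical_weight \<alpha> \<gamma> n * dist_int (real n * \<beta>) \<le> \<epsilon>"
    proof (cases "critical_weight \<alpha> \<gamma> n = 0")
      case False
      then have "critical_weight \<alpha> \<gamma> n > 0"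
        using critical_weight_nonneg[of \<alpha> \<gamma> n] by linarith
      then show ?thesis using d by (simp add: critical_psi_def field_simps)
    qed (use \<epsilon> in simp)
    then show "n < n0" using n0[of n] by (meson not_le)
  qed
  then have "finite {(n :: nat, r :: int). n \<ge> 1 \<and> coprime (int n) r \<and>
        \<bar>real n * \<beta> - real_of_int r\<bar> < critical_psi \<epsilon> \<alpha> \<gamma> n}"
    by (rule finite_subset) (intro finite_SigmaI finite_ints_near finite_lessThan)
  then show False using inf by contradiction
qed

theorem theorem2p4:
  fixes \<gamma> \<alpha> :: real
  assumes "\<alpha> \<notin> Liouville_numbers \<union> \<rat>"
    and "Duffin_Schaeffer_conjecture"
  shows "AE \<beta> in lebesgue.
           liminf (\<lambda>n. ereal (real n * (ln (real n))\<^sup>2 *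
             dist_int (real n * \<alpha> - \<gamma>) * dist_int (real n * \<beta>))) = 0"
proof -
  define \<epsilon> where "\<epsilon> k = inverse (real (Suc k))" for k
  have \<epsilon>: "\<epsilon> k > 0" for k by (simp add: \<epsilon>_def)
  have "AE \<beta> in lebesgue. \<forall>k. infinite {(n :: nat, r :: int). n \<ge> 1 \<and> coprime (int n) r \<and>
          \<bar>real n * \<beta> - real_of_int r\<bar> < critical_psi (\<epsilon> k) \<alpha> \<gamma> n}"
    unfolding AE_all_countable
    using assms(2) critical_psi_pos[OF \<epsilon>] critical_series_diverges[OF assms(1) \<epsilon>]
    unfolding Duffin_Schaeffer_conjecture_def by simp
  then show ?thesis
  proof (rule AE_mp, intro AE_I2 impI)
    fix \<beta> assume inf: "\<forall>k. infinite {(n :: nat, r :: int). n \<ge> 1 \<and> coprime (int n) r \<and>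
          \<bar>real n * \<beta> - real_of_int r\<bar> < critical_psi (\<epsilon> k) \<alpha> \<gamma> n}"
    let ?l = "liminf (\<lambda>n. ereal (critical_weight \<alpha> \<gamma> n * dist_int (real n * \<beta>)))"
    have "?l \<ge> 0"
      by (intro Liminf_bounded always_eventually)
        (simp add: critical_weight_nonneg dist_int_nonneg)
    moreover have "?l \<le> 0"
    proof (rule LIMSEQ_le_const)
      show "(\<lambda>k. ereal (\<epsilon> k)) \<longlonglongrightarrow> 0"
        unfolding \<epsilon>_def zero_ereal_def by (intro tendsto_ereal LIMSEQ_inverse_real_of_nat)
      show "\<exists>K. \<forall>k\<ge>K. ?l \<le> ereal (\<epsilon> k)"
        using liminf_le_of_approximations[OF \<epsilon>] inf by blast
    qed
    ultimately show "liminf (\<lambda>n. ereal (real n * (ln (real n))\<^sup>2 *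
        dist_int (real n * \<alpha> - \<gamma>) * dist_int (real n * \<beta>))) = 0"
      by (simp add: critical_weight_def)
  qed
qed

end
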